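(* For every $n\ge 32$, let $f_7\colon\{0,1\}^n\to\{0,1,\perp\}$ be given by $f_7(x)=0$ if $|x|\le 7$, $f_7(x)=\perp$ if $8\le|x|\le n-1$, $f_7(x)=1$ if $|x|=n$, and $F_7(x,y)=f_7(x\oplus y)$. Then $\mathrm{D_{cc}^{\rightarrow}}(F_7)\le 7$, whereas $\mathrm{NADT^{\oplus}}(f_7)=8$.
   Context: $|x|$ is Hamming weight, $\oplus$ is bitwise XOR. $\operatorname{Dom}(f)=f^{-1}(\{0,1\})$, $\operatorname{Dom}(F)=\{(x,y):x\oplus y\in\operatorname{Dom}(f)\}$. $\mathrm{D_{cc}^{\rightarrow}}(F)$ is the minimum $t$ such that there are total $h\colon\{0,1\}^n\to\{0,1\}^t$ and $\varphi\colon\{0,1\}^t\times\{0,1\}^n\to\{0,1\}$ with $\varphi(h(x),y)=F(x,y)$ for all $(x,y)\in\operatorname{Dom}(F)$. With $\langle s,x\rangle=\bigoplus_is_i\wedge x_i$, $\mathrm{NADT^{\oplus}}(f)$ is the minimum $p$ such that there are $s_1,\dots,s_p\in\{0,1\}^n$ and total $l\colon\{0,1\}^p\to\{0,1\}$ with $l(\langle s_1,x\rangle,\dots,\langle s_p,x\rangle)=f(x)$ for all $x\in\operatorname{Dom}(f)$. *)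

theory Defs
  imports Main
begin

definition bitstrings :: "nat \<Rightarrow> bool list set" where
  "bitstrings n = {x. length x = n}"

definition hamming_weight :: "bool list \<Rightarrow> nat" where
  "hamming_weight x = count_list x True"

definition bxor :: "bool list \<Rightarrow> bool list \<Rightarrow> bool list" (infixl "\<oplus>" 65) where
  "x \<oplus> y = map2 (\<noteq>) x y"

definition parity_inner :: "bool list \<Rightarrow> bool list \<Rightarrow> bool" where
  "parity_inner s x = foldr (\<noteq>) (map2 (\<and>) s x) False"

text \<open>Partial Boolean functions take values in \<^typ>\<open>bool option\<close>, with \<^term>\<open>None\<close> for \<open>\<bottom>\<close>;
  only their values on bit strings of length \<open>n\<close> matter.\<close>

definition pdom :: "nat \<Rightarrow> (bool list \<Rightarrow> bool option) \<Rightarrow> bool list set" where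
  "pdom n f = {x \<in> bitstrings n. f x \<in> {Some False, Some True}}"

definition pdom2 :: "nat \<Rightarrow> (bool list \<Rightarrow> bool list \<Rightarrow> bool option) \<Rightarrow> (bool list \<times> bool list) set" where
  "pdom2 n F = {(x, y) \<in> bitstrings n \<times> bitstrings n. F x y \<in> {Some False, Some True}}"

definition xor_lift :: "(bool list \<Rightarrow> bool option) \<Rightarrow> bool list \<Rightarrow> bool list \<Rightarrow> bool option" where
  "xor_lift f x y = f (x \<oplus> y)"

definition one_way_protocol ::
    "nat \<Rightarrow> (bool list \<Rightarrow> bool list \<Rightarrow> bool option) \<Rightarrow> nat \<Rightarrow> bool" where
  "one_way_protocol n F t \<longleftrightarrow>
     (\<exists>(h :: bool list \<Rightarrow> bool list) (\<phi> :: bool list \<Rightarrow> bool list \<Rightarrow> bool).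
        (\<forall>x \<in> bitstrings n. h x \<in> bitstrings t) \<and>
        (\<forall>(x, y) \<in> pdom2 n F. F x y = Some (\<phi> (h x) y)))"

definition D_cc_one_way :: "nat \<Rightarrow> (bool list \<Rightarrow> bool list \<Rightarrow> bool option) \<Rightarrow> nat" where
  "D_cc_one_way n F = (LEAST t. one_way_protocol n F t)"

definition nonadaptive_parity_tree :: "nat \<Rightarrow> (bool list \<Rightarrow> bool option) \<Rightarrow> nat \<Rightarrow> bool" where
  "nonadaptive_parity_tree n f p \<longleftrightarrow>
     (\<exists>(ss :: bool list list) (l :: bool list \<Rightarrow> bool).
        length ss = p \<and> set ss \<subseteq> bitstrings n \<and>
        (\<forall>x \<in> pdom n f. f x = Some (l (map (\<lambda>s. parity_inner s x) ss))))"

definition NADT_parity :: "nat \<Rightarrow> (bool list \<Rightarrow> bool option) \<Rightarrow> nat" where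
  "NADT_parity n f = (LEAST p. nonadaptive_parity_tree n f p)"

definition f7 :: "nat \<Rightarrow> bool list \<Rightarrow> bool option" where
  "f7 n x = (if hamming_weight x \<le> 7 then Some False
             else if hamming_weight x = n then Some True
             else None)"

definition F7 :: "nat \<Rightarrow> bool list \<Rightarrow> bool list \<Rightarrow> bool option" where
  "F7 n = xor_lift (f7 n)"

lemma pdom2_xor_lift:
  "pdom2 n (xor_lift f) = {(x, y) \<in> bitstrings n \<times> bitstrings n. x \<oplus> y \<in> pdom n f}"
  by (auto simp: pdom2_def pdom_def xor_lift_def bxor_def bitstrings_def)

text \<open>Both minima range over nonempty sets, so \<^const>\<open>Least\<close> is the genuine minimum.\<close>

lemma one_way_protocol_trivial: "one_way_protocol n F n"
  unfolding one_way_protocol_def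
  by (rule exI[of _ id], rule exI[of _ "\<lambda>x y. the (F x y)"]) (auto simp: pdom2_def)

lemma parity_inner_zeros: "parity_inner (replicate k False) x = False"
proof (induction k arbitrary: x)
  case 0
  then show ?case by (simp add: parity_inner_def)
next
  case (Suc k)
  then show ?case by (cases x) (simp_all add: parity_inner_def)
qed

lemma parity_inner_unit:
  "i < length x \<Longrightarrow> parity_inner ((replicate (length x) False)[i := True]) x = x ! i"
proof (induction x arbitrary: i)
  case Nil
  then show ?case by simp
next
  case (Cons a x)
  show ?case
  proof (cases i)
    case 0
    then show ?thesis using parity_inner_zeros[of "length x" x] by (simp add: parity_inner_def)
  next
    case (Suc j)
    then show ?thesis using Cons by (simp add: parity_inner_def)
  qed
qed

lemma nonadaptive_parity_tree_trivial: "nonadaptive_parity_tree n f n"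
proof -
  let ?ss = "map (\<lambda>i. (replicate n False)[i := True]) [0..<n]"
  have *: "map (\<lambda>s. parity_inner s x) ?ss = x" if "length x = n" for x
    using that by (intro nth_equalityI) (auto simp: parity_inner_unit)
  show ?thesis
    unfolding nonadaptive_parity_tree_def
    apply (rule exI[of _ ?ss], rule exI[of _ "\<lambda>x. the (f x)"])
    apply (intro conjI ballI)
      apply simp
     apply (auto simp: bitstrings_def)[1]
    subgoal for x
      using *[of x] by (auto simp: pdom_def bitstrings_def)
    done
qed

lemma D_cc_one_way_protocol: "one_way_protocol n F (D_cc_one_way n F)"
  unfolding D_cc_one_way_def by (rule LeastI, rule one_way_protocol_trivial)

lemma NADT_parity_tree: "nonadaptive_parity_tree n f (NADT_parity n f)"
  unfolding NADT_parity_def by (rule LeastI, rule nonadaptive_parity_tree_trivial)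

end

theory Submission
  imports Defs
begin

text \<open>
  The parity lower bound: with at most 7 parities, some \<open>x\<close> of weight at most 7 has the same parities
  as the all-ones string. Indeed, a string of minimal weight among those with given \<open>p\<close> parities has
  weight at most \<open>p\<close>: otherwise, by pigeonhole, two distinct subsets of its support have equal
  parities, and adding their symmetric difference lowers the weight. Eight parities suffice, by
  reading eight coordinates.

  The protocol: \<open>F7 n x y\<close> is true only if \<open>x\<close> is the complement of \<open>y\<close>. Alice sends the four message
  bits of the Hamming-decoding of her first seven coordinates and the next three coordinates
  verbatim. As the [7,4] Hamming code has covering radius 1, two strings with equal messages differ
  in at most two of the first ten coordinates; hence if Bob finds that his complement \<open>- y\<close> has the
  same message as \<open>x\<close>, then \<open>x\<close> and \<open>y\<close> differ in at least eight places.
\<close>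

section \<open>Strings as sets of positions\<close>

definition char_string :: "nat \<Rightarrow> nat set \<Rightarrow> bool list" where
  "char_string n S = map (\<lambda>i. i \<in> S) [0..<n]"

lemma length_char_string [simp]: "length (char_string n S) = n"
  by (simp add: char_string_def)

lemma hamming_weight_conv_card: "hamming_weight x = card {i. i < length x \<and> x ! i}"
proof -
  have "hamming_weight x = length (filter id x)"
    unfolding hamming_weight_def by (induction x) auto
  then show ?thesis
    by (simp add: length_filter_conv_card)
qed

lemma hamming_weight_char_string:
  assumes "S \<subseteq> {..<n}"
  shows "hamming_weight (char_string n S) = card S"
proof -
  have "{i. i < n \<and> char_string n S ! i} = S"
    using assms by (auto simp: char_string_def)
  then show ?thesis
    by (simp add: hamming_weight_conv_card)
qed

lemma bxor_char_string:
  "char_string n S \<oplus> char_string n T = char_string n ((S - T) \<union> (T - S))"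
  by (intro nth_equalityI) (auto simp: char_string_def bxor_def)

lemma parity_inner_bxor:
  "length x = length y \<Longrightarrow>
    parity_inner s (x \<oplus> y) \<longleftrightarrow> parity_inner s x \<noteq> parity_inner s y"
proof (induction x y arbitrary: s rule: list_induct2)
  case Nil
  then show ?case by (simp add: parity_inner_def bxor_def)
next
  case (Cons a x b y)
  then show ?case
    by (cases s) (auto simp: parity_inner_def bxor_def)
qed

section \<open>Parity decision trees\<close>

lemma exists_light_string_with_same_parities:
  "\<exists>T \<subseteq> {..<n}. card T \<le> length ss \<and>
     map (\<lambda>s. parity_inner s (char_string n T)) ss = map (\<lambda>s. parity_inner s (char_string n S)) ss"
  if "S \<subseteq> {..<n}"
  using that
proof (induction "card S" arbitrary: S rule: less_induct)
  case less
  let ?par = "\<lambda>T. map (\<lambda>s. parity_inner s (char_string n T)) ss"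
  have finS: "finite S"
    using less.prems finite_subset by blast
  show ?case
  proof (cases "card S \<le> length ss")
    case True
    then show ?thesis using less.prems by blast
  next
    case False
    have sub: "?par ` Pow S \<subseteq> {v. set v \<subseteq> UNIV \<and> length v = length ss}"
      by auto
    have "card (?par ` Pow S) \<le> card {v :: bool list. set v \<subseteq> UNIV \<and> length v = length ss}"
      by (intro card_mono[OF _ sub] finite_lists_length_eq) simp
    also have "\<dots> = 2 ^ length ss"
      by (subst card_lists_length_eq) simp_all
    \<comment> \<open>\<open>S\<close> has \<open>2 ^ card S\<close> subsets, more than there are
      parity vectors of length \<open>length ss\<close>.\<close>
    also have "\<dots> < card (Pow S)"
      using False finS by (simp add: card_Pow)
    finally have "\<not> inj_on ?par (Pow S)"
      by (rule pigeonhole)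
    then obtain A B where AB: "A \<subseteq> S" "B \<subseteq> S" "A \<noteq> B" "?par A = ?par B"
      by (auto simp: inj_on_def)
    define D where "D = (A - B) \<union> (B - A)"
    have D: "D \<subseteq> S" "D \<noteq> {}"
      using AB by (auto simp: D_def)
    have parD: "\<not> parity_inner s (char_string n D)" if "s \<in> set ss" for s
      using AB(4) that by (simp add: D_def bxor_char_string[symmetric] parity_inner_bxor)
    \<comment> \<open>Since \<open>D\<close> lies inside \<open>S\<close>, XOR with \<open>D\<close>
      only deletes positions; since all parities of \<open>D\<close> vanish, the parity vector
      survives.\<close>
    have "char_string n S \<oplus> char_string n D = char_string n (S - D)"
      using D by (simp add: bxor_char_string Diff_eq_empty_iff[THEN iffD2])
    then have par: "?par (S - D) = ?par S"
      using parD parity_inner_bxor[of "char_string n S" "char_string n D"] by simp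
    have "card (S - D) < card S"
      using D finS by (intro psubset_card_mono) auto
    moreover have "S - D \<subseteq> {..<n}"
      using less.prems by blast
    ultimately show ?thesis
      unfolding par[symmetric] by (rule less.hyps)
  qed
qed

lemma nonadaptive_parity_tree_f7_ge:
  assumes "n \<ge> 8" and "nonadaptive_parity_tree n (f7 n) p"
  shows "p \<ge> 8"
proof (rule ccontr)
  assume "\<not> p \<ge> 8"
  obtain ss l where ss: "length ss = p"
    and l: "\<And>x. x \<in> pdom n (f7 n) \<Longrightarrow> f7 n x = Some (l (map (\<lambda>s. parity_inner s x) ss))"
    using assms(2) unfolding nonadaptive_parity_tree_def by blast
  obtain T where T: "T \<subseteq> {..<n}" "card T \<le> length ss"
    and eq: "map (\<lambda>s. parity_inner s (char_string n T)) ss =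
             map (\<lambda>s. parity_inner s (char_string n {..<n})) ss"
    using exists_light_string_with_same_parities[of "{..<n}" n ss] by blast
  have 0: "f7 n (char_string n T) = Some False"
    using T ss \<open>\<not> p \<ge> 8\<close> by (simp add: f7_def hamming_weight_char_string)
  have 1: "f7 n (char_string n {..<n}) = Some True"
    using assms(1) by (simp add: f7_def hamming_weight_char_string)
  show False
    using l[of "char_string n T"] l[of "char_string n {..<n}"] 0 1 eq
    by (simp add: pdom_def bitstrings_def)
qed

lemma nonadaptive_parity_tree_f7:
  assumes "n \<ge> 8"
  shows "nonadaptive_parity_tree n (f7 n) 8"
  unfolding nonadaptive_parity_tree_def
proof (intro exI conjI ballI)
  let ?ss = "map (\<lambda>i. (replicate n False)[i := True]) [0..<8]"
  show "length ?ss = 8" by simp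
  show "set ?ss \<subseteq> bitstrings n" by (auto simp: bitstrings_def)
  fix x assume x: "x \<in> pdom n (f7 n)"
  then have len: "length x = n" by (simp add: pdom_def bitstrings_def)
  have par: "map (\<lambda>s. parity_inner s x) ?ss = map (\<lambda>i. x ! i) [0..<8]"
    using assms len parity_inner_unit[of _ x] by auto
  let ?S = "{i. i < n \<and> x ! i}"
  have w: "hamming_weight x = card ?S"
    using len by (simp add: hamming_weight_conv_card)
  \<comment> \<open>The decision function is conjunction: a string of weight at most 7 cannot have
    eight ones.\<close>
  show "f7 n x = Some (list_all id (map (\<lambda>s. parity_inner s x) ?ss))"
  proof (cases "hamming_weight x \<le> 7")
    case True
    have "\<not> {..<8} \<subseteq> ?S"
      using card_mono[of ?S "{..<8}"] True w by auto
    then show ?thesis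
      using True assms unfolding par by (auto simp: f7_def list_all_iff)
  next
    case False
    then have "hamming_weight x = n"
      using x by (auto simp: pdom_def f7_def split: if_splits)
    then have "?S = {..<n}"
      using w by (intro card_subset_eq) auto
    then have "i \<in> ?S" if "i < 8" for i
      using that assms by (metis lessThan_iff less_le_trans)
    then have "x ! i" if "i < 8" for i
      using that by blast
    then show ?thesis
      using False \<open>hamming_weight x = n\<close> unfolding par
      by (simp add: f7_def list_all_iff)
  qed
qed

section \<open>The one-way protocol\<close>

text \<open>Coordinates 1, 2 and 4 carry the checks, so that the syndrome \<open>(p, q, r)\<close> is the binary
  expansion, least significant bit first, of the position to be corrected.\<close>

fun hamming_message :: "bool list \<Rightarrow> bool list" where
  "hamming_message (a1 # a2 # a3 # a4 # a5 # a6 # a7 # a8 # a9 # a10 # _) =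
    (let p = (a1 \<noteq> (a3 \<noteq> (a5 \<noteq> a7)));
         q = (a2 \<noteq> (a3 \<noteq> (a6 \<noteq> a7)));
         r = (a4 \<noteq> (a5 \<noteq> (a6 \<noteq> a7)))
     in [a3 \<noteq> (p \<and> q \<and> \<not> r), a5 \<noteq> (p \<and> \<not> q \<and> r), a6 \<noteq> (\<not> p \<and> q \<and> r), a7 \<noteq> (p \<and> q \<and> r),
         a8, a9, a10])"
| "hamming_message _ = replicate 7 False"

text \<open>Positions 1, 2 and 4 are chosen so that the syndrome bits \<open>p\<close>,
  \<open>q\<close>, \<open>r\<close> vanish; \<open>ms\<close> is copied uncoded.\<close>

fun hamming_codeword :: "bool list \<Rightarrow> bool list" where
  "hamming_codeword (m1 # m2 # m3 # m4 # ms) =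
    [m1 \<noteq> (m2 \<noteq> m4), m1 \<noteq> (m3 \<noteq> m4), m1, m2 \<noteq> (m3 \<noteq> m4), m2, m3, m4] @ ms"
| "hamming_codeword _ = []"

text \<open>The default value has length 7 as well, so short lists are no exception.\<close>

lemma length_hamming_message: "length (hamming_message x) = 7"
  by (induction x rule: hamming_message.induct) (simp_all add: Let_def)

lemma hamming_weight_Nil [simp]: "hamming_weight [] = 0"
  by (simp add: hamming_weight_def)

lemma hamming_weight_Cons [simp]:
  "hamming_weight (a # x) = of_bool a + hamming_weight x"
  by (simp add: hamming_weight_def)

lemma bxor_Nil [simp]: "[] \<oplus> [] = []"
  by (simp add: bxor_def)

lemma bxor_Cons [simp]: "(a # x) \<oplus> (b # y) = (a \<noteq> b) # (x \<oplus> y)"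
  by (simp add: bxor_def)

lemma length_10E:
  assumes "length x = 10"
  obtains a1 a2 a3 a4 a5 a6 a7 a8 a9 a10 where "x = [a1, a2, a3, a4, a5, a6, a7, a8, a9, a10]"
  using assms by (auto simp: numeral_eq_Suc length_Suc_conv)

lemma length_hamming_codeword:
  "length x = 10 \<Longrightarrow> length (hamming_codeword (hamming_message x)) = 10"
  by (elim length_10E) (simp add: Let_def)

lemma hamming_covering_radius:
  assumes "length x = 10"
  shows "hamming_weight (x \<oplus> hamming_codeword (hamming_message x)) \<le> 1"
proof -
  obtain a1 a2 a3 a4 a5 a6 a7 a8 a9 a10 where x: "x = [a1, a2, a3, a4, a5, a6, a7, a8, a9, a10]"
    using assms by (rule length_10E)
  show ?thesis
    unfolding x
    \<comment> \<open>All 128 words of the [7,4] block are checked; \<open>a8\<close>,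
      \<open>a9\<close>, \<open>a10\<close> cancel symbolically.\<close>
    by (cases a1; cases a2; cases a3; cases a4; cases a5; cases a6; cases a7) (simp_all add: Let_def)
qed

text \<open>Every position counts at least once: where \<open>x\<close> and \<open>y\<close> agree,
  \<open>x\<close> and \<open>map Not y\<close> differ, so \<open>c\<close> differs from one of
  them.\<close>

lemma hamming_weight_bxor_complement:
  assumes "length x = length c" and "length c = length y"
  shows "length x \<le> hamming_weight (x \<oplus> y) +
    hamming_weight (x \<oplus> c) + hamming_weight (map Not y \<oplus> c)"
  using assms by (induction x c y rule: list_induct3) auto

lemma hamming_weight_take_le: "hamming_weight (take k x) \<le> hamming_weight x"
  by (induction x arbitrary: k) (auto simp: take_Cons split: nat.split)

lemma hamming_message_take:
  assumes "10 \<le> length x"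
  shows "hamming_message (take 10 x) = hamming_message x"
proof -
  have "length (take 10 x) = 10" using assms by simp
  then obtain a1 a2 a3 a4 a5 a6 a7 a8 a9 a10
    where "take 10 x = [a1, a2, a3, a4, a5, a6, a7, a8, a9, a10]"
    by (rule length_10E)
  then have "x = [a1, a2, a3, a4, a5, a6, a7, a8, a9, a10] @ drop 10 x"
    by (metis append_take_drop_id)
  then obtain xs where xs: "x = [a1, a2, a3, a4, a5, a6, a7, a8, a9, a10] @ xs" ..
  show ?thesis
    unfolding xs by simp
qed

text \<open>Both prefixes lie within distance 1 of the common codeword \<open>?c\<close>, which
  leaves at least 10 - 1 - 1 = 8 differences between \<open>x\<close> and \<open>y\<close>.\<close>

lemma hamming_message_eq_complement:
  assumes len: "length x = length y" "10 \<le> length x"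
    and eq: "hamming_message x = hamming_message (map Not y)"
  shows "8 \<le> hamming_weight (x \<oplus> y)"
proof -
  let ?x = "take 10 x" and ?y = "take 10 y"
  let ?c = "hamming_codeword (hamming_message ?x)"
  have c: "?c = hamming_codeword (hamming_message (map Not ?y))"
    using len eq hamming_message_take[of x] hamming_message_take[of "map Not y"]
    by (simp add: take_map)
  have "10 \<le> hamming_weight (?x \<oplus> ?y) + hamming_weight (?x \<oplus> ?c) + hamming_weight (map Not ?y \<oplus> ?c)"
    using hamming_weight_bxor_complement[of ?x ?c ?y] len length_hamming_codeword[of ?x] by simp
  moreover have "hamming_weight (?x \<oplus> ?c) \<le> 1"
    using len by (intro hamming_covering_radius) simp
  moreover have "hamming_weight (map Not ?y \<oplus> ?c) \<le> 1"
    unfolding c using len by (intro hamming_covering_radius) simp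
  moreover have "?x \<oplus> ?y = take 10 (x \<oplus> y)"
    by (simp add: bxor_def take_map take_zip)
  ultimately show ?thesis
    using hamming_weight_take_le[of 10 "x \<oplus> y"] by simp
qed

lemma full_weight_bxor:
  assumes "length x = length y" and "hamming_weight (x \<oplus> y) = length x"
  shows "x = map Not y"
proof -
  \<comment> \<open>Applied to the tails, this excludes equal heads: the tails alone could not reach
    full weight.\<close>
  have "hamming_weight (u \<oplus> v) \<le> length u" if "length u = length v" for u v
    using that by (induction u v rule: list_induct2) auto
  with assms show ?thesis
  proof (induction x y rule: list_induct2)
    case (Cons a x b y)
    then show ?case
      using Cons.prems(2)[of x y] by (cases "a = b") auto
  qed simp
qed

lemma one_way_protocol_F7:
  assumes "n \<ge> 10"
  shows "one_way_protocol n (F7 n) 7"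
  unfolding one_way_protocol_def
proof (intro exI conjI ballI)
  show "hamming_message x \<in> bitstrings 7" for x
    by (simp add: bitstrings_def length_hamming_message)
  fix z assume "z \<in> pdom2 n (F7 n)"
  then obtain x y where z: "z = (x, y)" and len: "length x = n" "length y = n"
    and dom: "F7 n x y \<in> {Some False, Some True}"
    by (auto simp: pdom2_def bitstrings_def)
  \<comment> \<open>Bob answers true exactly when the message of his complement is the one
    received.\<close>
  have "F7 n x y = Some (hamming_message x = hamming_message (map Not y))"
  proof (cases "hamming_weight (x \<oplus> y) \<le> 7")
    case True
    then show ?thesis
      using hamming_message_eq_complement[of x y] len assms
      by (auto simp: F7_def xor_lift_def f7_def)
  next
    case False
    then have "hamming_weight (x \<oplus> y) = n"
      using dom by (auto simp: F7_def xor_lift_def f7_def split: if_splits)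
    then show ?thesis
      using False full_weight_bxor[of x y] len by (simp add: F7_def xor_lift_def f7_def)
  qed
  then show "case z of (x, y) \<Rightarrow>
      F7 n x y = Some ((\<lambda>m y. m = hamming_message (map Not y)) (hamming_message x) y)"
    by (simp add: z)
qed

theorem theorem36:
  fixes n :: nat
  assumes "n \<ge> 32"
  shows "D_cc_one_way n (F7 n) \<le> 7 \<and> NADT_parity n (f7 n) = 8"
proof
  show "D_cc_one_way n (F7 n) \<le> 7"
    unfolding D_cc_one_way_def using assms by (intro Least_le one_way_protocol_F7) simp
  show "NADT_parity n (f7 n) = 8"
    unfolding NADT_parity_def
  proof (rule Least_equality)
    show "nonadaptive_parity_tree n (f7 n) 8"
      using assms by (intro nonadaptive_parity_tree_f7) simp
    show "8 \<le> p" if "nonadaptive_parity_tree n (f7 n) p" for p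
      using assms that nonadaptive_parity_tree_f7_ge[of n p] by simp
  qed
qed

end
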